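(* Assume that $f\not\equiv 0$, i.e. $f$ is not the zero element of $L^2(\Gamma,H';d\mu)$. Then the problem $$\max_{z\in H,\ z\ne 0}\ \int_\Gamma\frac{\langle f(\gamma),z\rangle^2}{a(z,z;\gamma)}\,d\mu(\gamma)$$ admits at least one solution; that is, the supremum over $z\in H\setminus\{0\}$ is attained.
   Context: Setting: $H$ is a separable real Hilbert space with norm $\|\cdot\|$, and $H'$ is its dual, with duality pairing $\langle\cdot,\cdot\rangle$. $B_s(H)$ is the space of continuous symmetric bilinear forms on $H$ (with its usual norm). $(\Gamma,\mathcal B,\mu)$ is a $\sigma$-finite measure space. $a\in L^\infty(\Gamma,B_s(H);d\mu)$ is such that there is $\alpha>0$ with $\alpha\|v\|^2\le a(v,v;\gamma)$ for all $v\in H$ and $\mu$-a.e. $\gamma\in\Gamma$, where $a(\cdot,\cdot;\gamma)$ denotes the form $a(\gamma)$. $f\in L^2(\Gamma,H';d\mu)$ is given. *)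

theory Defs
  imports "HOL-Analysis.Analysis"
begin

text \<open>
  Strong (Bochner) measurability. Borel measurability would not do here: the space of bilinear
  forms on an infinite-dimensional space is not separable, and the library's simple-function
  approximation and its integrability notion for vector-valued functions need a second countable
  codomain. On a $\sigma$-finite measure space it makes no difference whether the simple functions
  are required to have supports of finite measure.
\<close>

definition bochner_measurable :: "'g measure \<Rightarrow> ('g \<Rightarrow> 'b::real_normed_vector) \<Rightarrow> bool" where
  "bochner_measurable M f \<longleftrightarrow>
     (\<exists>s. (\<forall>n::nat. simple_function M (s n)) \<and> (AE x in M. (\<lambda>n. s n x) \<longlonglongrightarrow> f x))"

text \<open>
  Elements of the Lebesgue--Bochner spaces are represented by functions. All notions below are
  invariant under modification on a null set, so they are notions for the equivalence classes. For
  this reason integrals of nonnegative functions are written with the nonnegative integral: the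
  functions need only agree almost everywhere with a measurable one.
\<close>

definition L2_bochner :: "'g measure \<Rightarrow> ('g \<Rightarrow> 'b::real_normed_vector) set" where
  "L2_bochner M = {f. bochner_measurable M f \<and> (\<integral>\<^sup>+ x. ennreal ((norm (f x))\<^sup>2) \<partial>M) < \<infinity>}"

definition Linf_bochner :: "'g measure \<Rightarrow> ('g \<Rightarrow> 'b::real_normed_vector) set" where
  "Linf_bochner M = {f. bochner_measurable M f \<and> (\<exists>C. AE x in M. norm (f x) \<le> C)}"

text \<open>
  Continuous bilinear forms are curried; the operator norm of the nested type is the usual norm
  $\sup \{|b(u,v)| : \|u\|, \|v\| \le 1\}$.
\<close>

definition sym_forms :: "('h::real_normed_vector \<Rightarrow>\<^sub>L 'h \<Rightarrow>\<^sub>L real) set" where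
  "sym_forms = {b :: 'h \<Rightarrow>\<^sub>L 'h \<Rightarrow>\<^sub>L real. \<forall>u v. b u v = b v u}"

text \<open>
  The space of symmetric forms is the range of the continuous projection
  $b \mapsto (b + b^{T})/2$, so approximating simple functions may take values in all continuous
  bilinear forms.
\<close>

definition Linf_sym_forms ::
    "'g measure \<Rightarrow> ('g \<Rightarrow> ('h::real_normed_vector \<Rightarrow>\<^sub>L 'h \<Rightarrow>\<^sub>L real)) set" where
  "Linf_sym_forms M = {a \<in> Linf_bochner M. AE x in M. a x \<in> sym_forms}"

definition objective ::
    "'g measure \<Rightarrow> ('g \<Rightarrow> ('h::real_normed_vector \<Rightarrow>\<^sub>L 'h \<Rightarrow>\<^sub>L real)) \<Rightarrow> ('g \<Rightarrow> ('h \<Rightarrow>\<^sub>L real)) \<Rightarrow> 'h \<Rightarrow> ennreal" where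
  "objective M a f z = (\<integral>\<^sup>+ x. ennreal ((f x z)\<^sup>2 / a x z z) \<partial>M)"

end

theory Submission
  imports Defs "HOL-Complex_Analysis.Great_Picard"
begin

text \<open>
  The proof is the direct method. The objective $J$ is invariant under scaling, so a maximizing
  sequence may be chosen on the unit sphere; by weak sequential compactness of the unit ball
  (\<open>weakly_convergent_subsequence\<close>) it may also be assumed to converge weakly to some $l$.
  For almost every $\gamma$ the numerator is weakly continuous, while the denominator is weakly
  lower semicontinuous, being a convex continuous quadratic form. Hence the integrand is weakly
  upper semicontinuous along the sequence (\<open>limsup_quotient_le\<close>). Coercivity bounds
  all integrands on the unit sphere by the integrable function $\|f(\gamma)\|^2/\alpha$, so the
  reverse Fatou lemma gives $\sup J \le J(l)$.

  The unit sphere is not weakly closed, so it remains to exclude $l = 0$. With the convention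
  $0/0 = 0$ the integrand vanishes at $z = 0$, and the upper semicontinuity is still true when the
  weak limit is $0$, because then the numerators tend to $0$ and the denominators stay above
  $\alpha$. So $l = 0$ would force $\sup J \le 0$, whereas $f \neq 0$ and separability provide
  a direction in which $J$ is positive (\<open>exists_AE_nonzero_direction\<close>).
\<close>

section \<open>Weak compactness in separable Hilbert spaces\<close>

text \<open>
  The representing vector is the minimizer of the energy $\|x\|^2 - 2\varphi(x)$, whose
  Euler--Lagrange equation is $\varphi = \langle p, \cdot\rangle$. The minimizer exists because
  the parallelogram identity makes every minimizing sequence Cauchy.
\<close>

theorem riesz_representation:
  fixes \<phi> :: "'h::{real_inner, complete_space} \<Rightarrow> real"
  assumes "bounded_linear \<phi>"
  obtains p where "\<And>y. \<phi> y = p \<bullet> y"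
proof -
  interpret \<phi>: bounded_linear \<phi> by fact
  define E where "E x = x \<bullet> x - 2 * \<phi> x" for x
  obtain K where K: "\<And>x. \<bar>\<phi> x\<bar> \<le> norm x * K"
    using \<phi>.bounded by auto
  have E_ge: "- K\<^sup>2 \<le> E x" for x
  proof -
    have "0 \<le> (norm x - K)\<^sup>2" by simp
    then show ?thesis
      using K[of x] by (simp add: E_def power2_eq_square algebra_simps flip: power2_norm_eq_inner)
  qed
  then have bdd: "bdd_below (range E)" by (intro bdd_belowI[of _ "- K\<^sup>2"]) auto
  define m where "m = (INF x. E x)"
  have m_le: "m \<le> E x" for x
    unfolding m_def by (rule cINF_lower[OF bdd]) simp
  have "\<exists>x. E x < m + inverse (Suc n)" for n
  proof -
    have "(INF x. E x) < m + inverse (Suc n)" by (simp add: m_def)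
    then show ?thesis
      using cINF_less_iff[OF UNIV_not_empty bdd] by blast
  qed
  then obtain x where x: "\<And>n. E (x n) < m + inverse (Suc n)" by metis
  have parallelogram: "(norm (u - v))\<^sup>2 \<le> 2 * (E u - m) + 2 * (E v - m)" for u v
  proof -
    have "(norm (u - v))\<^sup>2 = 2 * E u + 2 * E v - 4 * E ((1/2) *\<^sub>R (u + v))"
      by (simp add: E_def power2_norm_eq_inner \<phi>.add \<phi>.scaleR inner_add_left inner_add_right
          inner_diff_left inner_diff_right inner_commute algebra_simps)
    then show ?thesis using m_le[of "(1/2) *\<^sub>R (u + v)"] by simp
  qed
  have "Cauchy x"
  proof (rule metric_CauchyI)
    fix e :: real assume "e > 0"
    then obtain N where N: "inverse (real (Suc N)) < e\<^sup>2 / 4"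
      using reals_Archimedean[of "e\<^sup>2 / 4"] by auto
    have "dist (x i) (x j) < e" if "i \<ge> N" "j \<ge> N" for i j
    proof -
      have near: "E (x k) - m < e\<^sup>2 / 4" if "k \<ge> N" for k
      proof -
        have "inverse (real (Suc k)) \<le> inverse (real (Suc N))"
          using that by (simp add: field_simps)
        then show ?thesis using x[of k] N by argo
      qed
      have "(norm (x i - x j))\<^sup>2 < e\<^sup>2"
        using parallelogram[of "x i" "x j"] near[OF that(1)] near[OF that(2)] by argo
      then show ?thesis
        using \<open>e > 0\<close> by (simp add: dist_norm power2_less_imp_less)
    qed
    then show "\<exists>N. \<forall>i\<ge>N. \<forall>j\<ge>N. dist (x i) (x j) < e" by blast
  qed
  then obtain p where p: "x \<longlonglongrightarrow> p"
    using Cauchy_convergent convergent_def by blast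
  have "(\<lambda>n. E (x n)) \<longlonglongrightarrow> E p"
    unfolding E_def by (intro tendsto_intros p \<phi>.tendsto)
  moreover have "(\<lambda>n. m + inverse (real (Suc n))) \<longlonglongrightarrow> m + 0"
    by (intro tendsto_intros LIMSEQ_inverse_real_of_nat)
  ultimately have "E p \<le> m + 0"
    by (rule LIMSEQ_le) (use x less_imp_le in blast)
  then have min: "E p \<le> E y" for y using m_le[of y] by simp
  \<comment> \<open>Along $p + t y$ the energy is a quadratic polynomial in $t$; it is evaluated at its vertex.\<close>
  have "\<phi> y = p \<bullet> y" for y
  proof (cases "y = 0")
    case False
    define n where "n = y \<bullet> y"
    define c where "c = p \<bullet> y - \<phi> y"
    have "n > 0" using False by (simp add: n_def)
    have "E (p + t *\<^sub>R y) = E p + 2 * t * c + t\<^sup>2 * n" for t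
      by (simp add: E_def n_def c_def \<phi>.add \<phi>.scaleR inner_add_left inner_add_right
          inner_commute power2_eq_square algebra_simps)
    then have "E (p + (- c / n) *\<^sub>R y) = E p + 2 * (- c / n) * c + (- c / n)\<^sup>2 * n" .
    also have "\<dots> = E p - c\<^sup>2 / n"
      using \<open>n > 0\<close> by (simp add: field_simps power2_eq_square)
    finally have "c\<^sup>2 / n \<le> 0" using min[of "p + (- c / n) *\<^sub>R y"] by simp
    then have "c = 0" using \<open>n > 0\<close> by (simp add: field_simps)
    then show ?thesis by (simp add: c_def)
  qed (simp add: \<phi>.zero)
  then show thesis by (rule that)
qed

text \<open>
  A diagonal argument makes the scalar products with a countable dense set converge, and
  boundedness extends this to all vectors. The limits form a bounded linear functional, which is
  represented by the weak limit.
\<close>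

lemma weakly_convergent_subsequence:
  fixes z :: "nat \<Rightarrow> 'h::{real_inner, polish_space}"
  assumes bound: "\<And>n. norm (z n) \<le> B"
  obtains r l where "strict_mono (r :: nat \<Rightarrow> nat)"
    and "\<And>\<phi> :: 'h \<Rightarrow> real. bounded_linear \<phi> \<Longrightarrow> (\<lambda>n. \<phi> (z (r n))) \<longlonglongrightarrow> \<phi> l"
proof -
  have "0 \<le> B" using order_trans[OF norm_ge_zero bound] .
  obtain D :: "'h set" where D: "countable D" "\<And>X. open X \<Longrightarrow> X \<noteq> {} \<Longrightarrow> \<exists>d\<in>D. d \<in> X"
    using countable_dense_setE by blast
  \<comment> \<open>The diagonal argument needs a bound that is uniform in the test vector, so the dense set is
    normalized first.\<close>
  have "norm (z n \<bullet> d) \<le> B" if "d \<in> sgn ` D" for n d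
  proof -
    have "norm d \<le> 1" using that by (auto simp: norm_sgn)
    then show ?thesis
      using Cauchy_Schwarz_ineq2[of "z n" d] mult_mono[OF bound[of n], of "norm d" 1] \<open>0 \<le> B\<close>
      by simp
  qed
  then obtain r where r: "strict_mono (r :: nat \<Rightarrow> nat)"
    and conv: "\<And>d. d \<in> sgn ` D \<Longrightarrow> \<exists>l. (\<lambda>n. z (r n) \<bullet> d) \<longlonglongrightarrow> l"
    using function_convergent_subsequence[of "sgn ` D" "\<lambda>n d. z n \<bullet> d" B] D(1)
    by (metis countable_image)
  have convD: "convergent (\<lambda>n. z (r n) \<bullet> d)" if "d \<in> D" for d
  proof -
    obtain l where "(\<lambda>n. z (r n) \<bullet> sgn d) \<longlonglongrightarrow> l" using conv \<open>d \<in> D\<close> by blast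
    then have "(\<lambda>n. norm d * (z (r n) \<bullet> sgn d)) \<longlonglongrightarrow> norm d * l" by (intro tendsto_intros)
    moreover have "norm d * (u \<bullet> sgn d) = u \<bullet> d" for u :: 'h
      by (cases "d = 0") (simp_all add: sgn_div_norm)
    ultimately show ?thesis by (auto simp: convergent_def)
  qed
  have "Cauchy (\<lambda>n. z (r n) \<bullet> y)" for y
  proof (rule metric_CauchyI)
    fix e :: real assume "e > 0"
    define \<delta> where "\<delta> = e / (3 * (B + 1))"
    have "\<delta> > 0" using \<open>e > 0\<close> \<open>0 \<le> B\<close> by (simp add: \<delta>_def)
    then obtain d where "d \<in> D" "d \<in> ball y \<delta>"
      using D(2)[of "ball y \<delta>"] by auto
    have "B * \<delta> \<le> e / 3"
      using \<open>e > 0\<close> \<open>0 \<le> B\<close> by (simp add: \<delta>_def field_simps)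
    have near: "\<bar>z n \<bullet> y - z n \<bullet> d\<bar> \<le> e / 3" for n
    proof -
      have "\<bar>z n \<bullet> (y - d)\<bar> \<le> norm (z n) * norm (y - d)" by (rule Cauchy_Schwarz_ineq2)
      also have "\<dots> \<le> B * \<delta>"
        using bound \<open>d \<in> ball y \<delta>\<close> \<open>0 \<le> B\<close> by (intro mult_mono) (auto simp: dist_norm)
      finally show ?thesis using \<open>B * \<delta> \<le> e / 3\<close> by (simp add: inner_diff_right)
    qed
    obtain N where N: "\<And>i j. i \<ge> N \<Longrightarrow> j \<ge> N \<Longrightarrow> dist (z (r i) \<bullet> d) (z (r j) \<bullet> d) < e / 3"
      using convergent_Cauchy[OF convD[OF \<open>d \<in> D\<close>]] \<open>e > 0\<close>
      by (meson metric_CauchyD divide_pos_pos zero_less_numeral)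
    have "dist (z (r i) \<bullet> y) (z (r j) \<bullet> y) < e" if "i \<ge> N" "j \<ge> N" for i j
      using N[OF that] near[of "r i"] near[of "r j"] unfolding dist_real_def by linarith
    then show "\<exists>N. \<forall>i\<ge>N. \<forall>j\<ge>N. dist (z (r i) \<bullet> y) (z (r j) \<bullet> y) < e" by blast
  qed
  then have "\<exists>l. (\<lambda>n. z (r n) \<bullet> y) \<longlonglongrightarrow> l" for y
    using real_Cauchy_convergent convergent_def by blast
  then obtain L where L: "\<And>y. (\<lambda>n. z (r n) \<bullet> y) \<longlonglongrightarrow> L y" by metis
  have "bounded_linear L"
  proof (rule bounded_linear_intro)
    show "L (x + y) = L x + L y" for x y
      using LIMSEQ_unique[OF L[of "x + y"]] tendsto_add[OF L[of x] L[of y]]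
      by (simp add: inner_add_right)
    show "L (c *\<^sub>R x) = c *\<^sub>R L x" for c x
      using LIMSEQ_unique[OF L[of "c *\<^sub>R x"]] tendsto_mult_left[OF L[of x], of c] by simp
    show "norm (L x) \<le> norm x * B" for x
    proof (rule LIMSEQ_le_const2[OF tendsto_norm[OF L[of x]]])
      have "norm (z (r n) \<bullet> x) \<le> norm x * B" for n
        using Cauchy_Schwarz_ineq2[of "z (r n)" x] mult_right_mono[OF bound[of "r n"], of "norm x"]
        by (simp add: mult.commute)
      then show "\<exists>N. \<forall>n\<ge>N. norm (z (r n) \<bullet> x) \<le> norm x * B" by blast
    qed
  qed
  then obtain l where l: "\<And>y. L y = l \<bullet> y" using riesz_representation by blast
  show thesis
  proof (rule that[OF r])
    fix \<phi> :: "'h \<Rightarrow> real" assume "bounded_linear \<phi>"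
    then obtain p where "\<And>y. \<phi> y = p \<bullet> y" using riesz_representation by blast
    then show "(\<lambda>n. \<phi> (z (r n))) \<longlonglongrightarrow> \<phi> l"
      using L[of p] by (simp add: l inner_commute)
  qed
qed

section \<open>Upper semicontinuity of the integrand\<close>

text \<open>
  For $l \neq 0$ the denominators are bounded below by their tangent at $l$,
  $b(z_n,z_n) \ge 2 b(l,z_n) - b(l,l)$, which is affine in $z_n$ and hence converges to
  $b(l,l) > 0$. For $l = 0$ the right-hand side is $0/0 = 0$, and the lower bound $\alpha$ for the
  denominators on the unit sphere is enough.
\<close>

lemma limsup_quotient_le:
  fixes b :: "'h::real_inner \<Rightarrow>\<^sub>L 'h \<Rightarrow>\<^sub>L real" and \<phi> :: "'h \<Rightarrow>\<^sub>L real"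
  assumes sym: "b \<in> sym_forms" and "\<alpha> > 0"
    and coercive: "\<And>v. \<alpha> * (norm v)\<^sup>2 \<le> b v v"
    and unit: "\<And>n. norm (z n) = 1"
    and weak: "\<And>\<psi> :: 'h \<Rightarrow> real. bounded_linear \<psi> \<Longrightarrow> (\<lambda>n. \<psi> (z n)) \<longlonglongrightarrow> \<psi> l"
  shows "limsup (\<lambda>n. ennreal ((\<phi> (z n))\<^sup>2 / b (z n) (z n))) \<le> ennreal ((\<phi> l)\<^sup>2 / b l l)"
proof -
  have \<phi>_lim: "(\<lambda>n. (\<phi> (z n))\<^sup>2) \<longlonglongrightarrow> (\<phi> l)\<^sup>2"
    by (intro tendsto_intros weak blinfun.bounded_linear_right)
  have "\<exists>v. v \<longlonglongrightarrow> (\<phi> l)\<^sup>2 / b l l \<and>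
      (\<forall>\<^sub>F n in sequentially. (\<phi> (z n))\<^sup>2 / b (z n) (z n) \<le> v n)"
  proof (cases "l = 0")
    case True
    have "(\<phi> (z n))\<^sup>2 / b (z n) (z n) \<le> (\<phi> (z n))\<^sup>2 / \<alpha>" for n
      using coercive[of "z n"] \<open>\<alpha> > 0\<close> by (intro divide_left_mono) (auto simp: unit)
    moreover have "(\<lambda>n. (\<phi> (z n))\<^sup>2 / \<alpha>) \<longlonglongrightarrow> (\<phi> l)\<^sup>2 / \<alpha>"
      using \<open>\<alpha> > 0\<close> by (intro tendsto_intros \<phi>_lim) simp
    ultimately show ?thesis using True by (auto simp: blinfun.zero_right)
  next
    case False
    define d where "d n = 2 * b l (z n) - b l l" for n
    have "0 < \<alpha> * (norm l)\<^sup>2" using False \<open>\<alpha> > 0\<close> by simp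
    then have pos: "b l l > 0" using coercive[of l] by linarith
    have "(\<lambda>n. 2 * b l (z n) - b l l) \<longlonglongrightarrow> 2 * b l l - b l l"
      by (intro tendsto_intros weak blinfun.bounded_linear_right)
    then have d_lim: "d \<longlonglongrightarrow> b l l" by (simp add: d_def[abs_def])
    have d_le: "d n \<le> b (z n) (z n)" for n
    proof -
      have "0 \<le> b (z n - l) (z n - l)"
        using coercive[of "z n - l"] \<open>\<alpha> > 0\<close> by (meson order_trans mult_nonneg_nonneg less_imp_le zero_le_power2)
      moreover have "b (z n) l = b l (z n)" using sym by (simp add: sym_forms_def)
      ultimately show ?thesis
        by (simp add: d_def blinfun.diff_left blinfun.diff_right)
    qed
    have "\<forall>\<^sub>F n in sequentially. 0 < d n"
      using order_tendstoD(1)[OF d_lim pos] .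
    then have "\<forall>\<^sub>F n in sequentially. (\<phi> (z n))\<^sup>2 / b (z n) (z n) \<le> (\<phi> (z n))\<^sup>2 / d n"
    proof eventually_elim
      case (elim n)
      then show ?case using d_le[of n] by (intro divide_left_mono) auto
    qed
    moreover have "(\<lambda>n. (\<phi> (z n))\<^sup>2 / d n) \<longlonglongrightarrow> (\<phi> l)\<^sup>2 / b l l"
      using pos by (intro tendsto_intros \<phi>_lim d_lim) simp
    ultimately show ?thesis by blast
  qed
  then obtain v where v: "v \<longlonglongrightarrow> (\<phi> l)\<^sup>2 / b l l"
    and le: "\<forall>\<^sub>F n in sequentially. (\<phi> (z n))\<^sup>2 / b (z n) (z n) \<le> v n" by blast
  have "limsup (\<lambda>n. ennreal ((\<phi> (z n))\<^sup>2 / b (z n) (z n))) \<le> limsup (\<lambda>n. ennreal (v n))"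
    by (intro Limsup_mono eventually_mono[OF le] ennreal_leI)
  also have "\<dots> = ennreal ((\<phi> l)\<^sup>2 / b l l)"
    using v by (intro lim_imp_Limsup) auto
  finally show ?thesis .
qed

section \<open>Measurability and null sets\<close>

text \<open>
  Integration theory is applied only to continuous scalar functions of $f(\gamma)$ and $a(\gamma)$,
  such as evaluations and norms. They are limits of real simple functions almost everywhere,
  so the nonseparability of the spaces of forms does no harm.
\<close>

lemma bochner_measurable_continuous_comp:
  fixes g :: "'b::real_normed_vector \<Rightarrow> real"
  assumes "bochner_measurable M f" "continuous_on UNIV g"
  obtains h where "h \<in> borel_measurable M" "AE x in M. g (f x) = h x"
proof -
  obtain s where s: "\<And>n::nat. simple_function M (s n)" "AE x in M. (\<lambda>n. s n x) \<longlonglongrightarrow> f x"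
    using assms(1) unfolding bochner_measurable_def by blast
  show thesis
  proof (rule that)
    show "(\<lambda>x. lim (\<lambda>n. g (s n x))) \<in> borel_measurable M"
      by (intro borel_measurable_lim_metric borel_measurable_simple_function
          simple_function_compose1[OF s(1)])
    show "AE x in M. g (f x) = lim (\<lambda>n. g (s n x))"
      using s(2)
    proof eventually_elim
      case (elim x)
      then have "(\<lambda>n. g (s n x)) \<longlonglongrightarrow> g (f x)"
        using continuous_on_tendsto_compose[OF assms(2)] by simp
      then show ?case by (simp add: limI)
    qed
  qed
qed

text \<open>
  Separability moves the quantifier over vectors inside: countably many null sets suffice for a
  dense set of vectors, and continuity does the rest. The next lemma rests on the same argument.
\<close>

lemma AE_coercive:
  fixes a :: "'g \<Rightarrow> ('h::{real_normed_vector, second_countable_topology} \<Rightarrow>\<^sub>L 'h \<Rightarrow>\<^sub>L real)"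
  assumes "\<And>v. AE x in M. \<alpha> * (norm v)\<^sup>2 \<le> a x v v"
  shows "AE x in M. \<forall>v. \<alpha> * (norm v)\<^sup>2 \<le> a x v v"
proof -
  obtain D :: "'h set" where D: "countable D" "\<And>X. open X \<Longrightarrow> X \<noteq> {} \<Longrightarrow> \<exists>d\<in>D. d \<in> X"
    using countable_dense_setE by blast
  have "AE x in M. \<forall>v\<in>D. \<alpha> * (norm v)\<^sup>2 \<le> a x v v"
    using assms D(1) by (simp add: AE_ball_countable)
  then show ?thesis
  proof eventually_elim
    case (elim x)
    show ?case
    proof (rule ccontr)
      assume "\<not> ?thesis"
      then have "{v. a x v v < \<alpha> * (norm v)\<^sup>2} \<noteq> {}" by (auto simp: not_le)
      moreover have "open {v. a x v v < \<alpha> * (norm v)\<^sup>2}"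
        by (intro open_Collect_less continuous_intros)
      ultimately show False using D(2) elim by fastforce
    qed
  qed
qed

lemma exists_AE_nonzero_direction:
  fixes f :: "'g \<Rightarrow> ('h::{real_normed_vector, second_countable_topology} \<Rightarrow>\<^sub>L real)"
  assumes "\<not> (AE x in M. f x = 0)"
  obtains w where "\<not> (AE x in M. f x w = 0)"
proof (rule ccontr)
  assume "\<not> thesis"
  then have all: "AE x in M. f x w = 0" for w using that by blast
  obtain D :: "'h set" where D: "countable D" "\<And>X. open X \<Longrightarrow> X \<noteq> {} \<Longrightarrow> \<exists>d\<in>D. d \<in> X"
    using countable_dense_setE by blast
  have "AE x in M. \<forall>w\<in>D. f x w = 0"
    using all D(1) by (simp add: AE_ball_countable)
  then have "AE x in M. f x = 0"
  proof eventually_elim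
    case (elim x)
    have "open {w. f x w \<noteq> 0}"
      by (intro open_Collect_neq continuous_intros)
    then have "f x w = 0" for w using D(2)[of "{w. f x w \<noteq> 0}"] elim by blast
    then show ?case by (intro blinfun_eqI) simp
  qed
  then show False using assms by simp
qed

section \<open>Existence of a maximizer\<close>

lemma objective_scaleR:
  assumes "c \<noteq> 0"
  shows "objective M a f (c *\<^sub>R z) = objective M a f z"
  using assms
  by (simp add: objective_def blinfun.scaleR_left blinfun.scaleR_right power2_eq_square)

theorem theorem3p3:
  fixes M :: "'g measure"
    and a :: "'g \<Rightarrow> ('h::{real_inner, polish_space} \<Rightarrow>\<^sub>L 'h \<Rightarrow>\<^sub>L real)"
    and f :: "'g \<Rightarrow> ('h \<Rightarrow>\<^sub>L real)"
    and \<alpha> :: real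
  assumes "sigma_finite_measure M"
    and "a \<in> Linf_sym_forms M"
    and "\<alpha> > 0"
    and "\<And>v. AE x in M. \<alpha> * (norm v)\<^sup>2 \<le> a x v v"
    and "f \<in> L2_bochner M"
    and "\<not> (AE x in M. f x = 0)"
  shows "\<exists>z. z \<noteq> 0 \<and> objective M a f z < \<infinity> \<and>
             (\<forall>w. w \<noteq> 0 \<longrightarrow> objective M a f w \<le> objective M a f z)"
proof -
  let ?J = "objective M a f"
  let ?q = "\<lambda>z x. ennreal ((f x z)\<^sup>2 / a x z z)"
  have a_meas: "bochner_measurable M a" and sym: "AE x in M. a x \<in> sym_forms"
    using assms(2) by (auto simp: Linf_sym_forms_def Linf_bochner_def)
  have f_meas: "bochner_measurable M f" and f_L2: "(\<integral>\<^sup>+ x. ennreal ((norm (f x))\<^sup>2) \<partial>M) < \<infinity>"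
    using assms(5) by (auto simp: L2_bochner_def)
  have coercive: "AE x in M. \<forall>v. \<alpha> * (norm v)\<^sup>2 \<le> a x v v"
    using assms(4) by (rule AE_coercive)
  \<comment> \<open>The integrands are only almost everywhere equal to Borel functions \<open>q z\<close>; these replace
    them wherever measurability matters.\<close>
  have "\<exists>q. q \<in> borel_measurable M \<and> (AE x in M. ?q z x = q x)" for z
  proof -
    obtain g where g: "g \<in> borel_measurable M" "AE x in M. f x z = g x"
      by (rule bochner_measurable_continuous_comp[OF f_meas, of "\<lambda>T. T z"])
        (intro continuous_intros)
    obtain h where h: "h \<in> borel_measurable M" "AE x in M. a x z z = h x"
      by (rule bochner_measurable_continuous_comp[OF a_meas, of "\<lambda>T. T z z"])
        (intro continuous_intros)
    have "(\<lambda>x. ennreal ((g x)\<^sup>2 / h x)) \<in> borel_measurable M"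
      using g(1) h(1) by measurable
    moreover have "AE x in M. ?q z x = ennreal ((g x)\<^sup>2 / h x)"
      using g(2) h(2) by eventually_elim simp
    ultimately show ?thesis by blast
  qed
  then have "\<exists>q. \<forall>z. q z \<in> borel_measurable M \<and> (AE x in M. ?q z x = q z x)"
    by (intro choice allI)
  then obtain q where q_meas: "\<And>z. q z \<in> borel_measurable M"
    and q_eq: "\<And>z. AE x in M. ?q z x = q z x" by blast
  have J_q: "?J z = (\<integral>\<^sup>+ x. q z x \<partial>M)" for z
    unfolding objective_def by (rule nn_integral_cong_AE[OF q_eq])
  obtain g where g: "g \<in> borel_measurable M" "AE x in M. (norm (f x))\<^sup>2 = g x"
    by (rule bochner_measurable_continuous_comp[OF f_meas, of "\<lambda>T. (norm T)\<^sup>2"])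
      (intro continuous_intros)
  \<comment> \<open>The integrable majorant $\|f\|^2/\alpha$ of the integrands on the unit sphere, in a Borel
    version.\<close>
  define W where "W x = ennreal (1 / \<alpha>) * ennreal (g x)" for x
  have W_meas: "W \<in> borel_measurable M" using g(1) unfolding W_def by measurable
  have "(\<integral>\<^sup>+ x. ennreal (g x) \<partial>M) = (\<integral>\<^sup>+ x. ennreal ((norm (f x))\<^sup>2) \<partial>M)"
    by (rule nn_integral_cong_AE) (use g(2) in eventually_elim, simp)
  then have W_fin: "(\<integral>\<^sup>+ x. W x \<partial>M) < \<infinity>"
    using f_L2 g(1) unfolding W_def
    by (subst nn_integral_cmult) (auto simp: ennreal_mult_less_top)
  have q_le: "AE x in M. q z x \<le> W x" if "norm z = 1" for z
    using coercive g(2) q_eq[of z]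
  proof eventually_elim
    case (elim x)
    have "\<alpha> \<le> a x z z" using elim(1) that by (metis mult.right_neutral power_one)
    moreover have "(f x z)\<^sup>2 \<le> (norm (f x))\<^sup>2"
      using norm_blinfun[of "f x" z] that by (simp add: abs_le_square_iff[symmetric])
    ultimately have "(f x z)\<^sup>2 / a x z z \<le> (norm (f x))\<^sup>2 / \<alpha>"
      using \<open>\<alpha> > 0\<close> by (intro frac_le) auto
    then have "?q z x \<le> ennreal (1 / \<alpha> * (norm (f x))\<^sup>2)"
      by (intro ennreal_leI) simp
    then show ?case
      using elim(2,3) \<open>\<alpha> > 0\<close> by (simp add: W_def flip: ennreal_mult')
  qed
  obtain w where w: "\<not> (AE x in M. f x w = 0)"
    by (rule exists_AE_nonzero_direction[OF assms(6)])
  then have "w \<noteq> 0" by (auto simp: blinfun.zero_right)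
  have "?J w \<noteq> 0"
  proof
    assume "?J w = 0"
    then have "AE x in M. q w x = 0"
      using nn_integral_0_iff_AE[OF q_meas] J_q by metis
    then have "AE x in M. f x w = 0"
      using coercive q_eq[of w]
    proof eventually_elim
      case (elim x)
      have "0 < \<alpha> * (norm w)\<^sup>2" using \<open>\<alpha> > 0\<close> \<open>w \<noteq> 0\<close> by simp
      then have "a x w w > 0" using elim(2) by (metis less_le_trans)
      moreover have "(f x w)\<^sup>2 / a x w w \<le> 0" using elim(1,3) by (metis ennreal_eq_0_iff)
      ultimately show ?case by (simp add: field_simps)
    qed
    then show False using w by simp
  qed
  define S where "S = (SUP z\<in>{z. norm z = 1}. ?J z)"
  have J_le: "?J z \<le> S" if "z \<noteq> 0" for z
  proof -
    have "?J (inverse (norm z) *\<^sub>R z) \<le> S"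
      unfolding S_def by (rule SUP_upper) (use that in simp)
    then show ?thesis using that by (simp add: objective_scaleR)
  qed
  have ne: "?J ` {z. norm z = 1} \<noteq> {}"
    using norm_sgn[of w] \<open>w \<noteq> 0\<close> by force
  obtain j :: "nat \<Rightarrow> ennreal" where "incseq j" "range j \<subseteq> ?J ` {z. norm z = 1}" "S = (SUP i. j i)"
    using ennreal_Sup_countable_SUP[OF ne] unfolding S_def by blast
  moreover then obtain z where unit: "\<And>n. norm (z n) = 1" and "\<And>n. j n = ?J (z n)"
    by (subst (asm) image_subset_iff) (force simp: image_iff dest: choice)
  ultimately have J_lim: "(\<lambda>n. ?J (z n)) \<longlonglongrightarrow> S"
    using LIMSEQ_SUP[of j] by (metis (no_types, lifting) ext)
  obtain r l where r: "strict_mono (r :: nat \<Rightarrow> nat)"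
    and weak: "\<And>\<phi> :: 'h \<Rightarrow> real. bounded_linear \<phi> \<Longrightarrow> (\<lambda>n. \<phi> (z (r n))) \<longlonglongrightarrow> \<phi> l"
    using weakly_convergent_subsequence[of z 1] unit by auto
  \<comment> \<open>Reverse Fatou lemma and pointwise upper semicontinuity.\<close>
  have "S = limsup (\<lambda>n. ?J (z (r n)))"
    using lim_imp_Limsup[OF _ LIMSEQ_subseq_LIMSEQ[OF J_lim r]] by (simp add: o_def)
  also have "\<dots> \<le> (\<integral>\<^sup>+ x. limsup (\<lambda>n. q (z (r n)) x) \<partial>M)"
    unfolding J_q
    by (rule nn_integral_limsup[where w = W]) (use W_fin in \<open>auto intro: q_meas W_meas q_le unit\<close>)
  also have "\<dots> \<le> ?J l"
    unfolding objective_def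
  proof (rule nn_integral_mono_AE)
    have "AE x in M. \<forall>n. ?q (z (r n)) x = q (z (r n)) x"
      using q_eq by (simp add: AE_all_countable)
    then show "AE x in M. limsup (\<lambda>n. q (z (r n)) x) \<le> ?q l x"
      using sym coercive
    proof eventually_elim
      case (elim x)
      have "limsup (\<lambda>n. ?q (z (r n)) x) \<le> ?q l x"
        using elim(2,3) \<open>\<alpha> > 0\<close> by (intro limsup_quotient_le weak) (auto simp: unit)
      then show ?case using elim(1) by simp
    qed
  qed
  finally have S_le: "S \<le> ?J l" .
  have "l \<noteq> 0"
  proof
    assume "l = 0"
    then have "?J l = 0" by (simp add: objective_def blinfun.zero_right)
    then show False using S_le J_le[OF \<open>w \<noteq> 0\<close>] \<open>?J w \<noteq> 0\<close> by simp
  qed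
  have "S \<le> (\<integral>\<^sup>+ x. W x \<partial>M)"
    unfolding S_def J_q by (intro SUP_least nn_integral_mono_AE q_le) simp
  then have "?J l < \<infinity>"
    using J_le[OF \<open>l \<noteq> 0\<close>] W_fin by (meson order_trans le_less_trans)
  then show ?thesis
    using \<open>l \<noteq> 0\<close> J_le S_le by (meson order_trans)
qed

end
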